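(* Let $\varepsilon,\delta>0$ and $n_0\in\mathbb{N}$, and for each integer $n\ge n_0$ let $M_n:\mathcal{X}^n\to\mathcal{Y}$ be a randomized algorithm that is $(\varepsilon,\delta)$-differentially private with respect to replacement of one element of its input. Then there exists a randomized algorithm $M_*:\mathcal{X}^*\to\mathcal{Y}\cup\{\bot\}$ that is $(2\varepsilon,2\delta)$-differentially private with respect to addition, removal, or replacement of one element of its input and has the following form. For any input $x\in\mathcal{X}^n$ of size $n$, $M_*(x)=M_N(\hat x)$, where $N$ is a random integer with $n\ge N\ge n-2\lceil\log(2/\delta)/\varepsilon\rceil$ and $\hat x\in\mathcal{X}^N$ is a uniformly random subset of $N$ elements of $x$; except that, if $N<n_0$, then $M_*$ simply outputs $\bot$.
   Context: $\mathcal{X}^*=\bigcup_{n=0}^\infty\mathcal{X}^n$; $\bot$ is a fixed failure symbol; $\log$ is the natural logarithm. A randomized algorithm $M$ is $(\varepsilon,\delta)$-differentially private with respect to a neighboring relation $\sim$ on its inputs if for all $x\sim x'$ and all measurable output sets $S$, $\Pr[M(x)\in S]\le e^\varepsilon\Pr[M(x')\in S]+\delta$. "With respect to replacement": $x\sim x'$ iff $x,x'$ have the same size and differ in one entry. "With respect to addition, removal, or replacement": $x\sim x'$ iff $x'$ can be obtained from $x$ by adding, removing or replacing one element. "Uniformly random subset of $N$ elements of $x$" means: conditioned on $N$, a uniformly random $N$-element set of indices in $[n]$ is chosen and $\hat x$ lists the corresponding entries of $x$ in some (possibly random) order. The internal randomness of $M_N$ is independent of the choice of $N$ and the subset.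
   Formalization: The lower bound on N uses max(0, ⌈log(2/δ)/ε⌉) in place of ⌈log(2/δ)/ε⌉; this differs only when δ ≥ 2e^ε, where the stated range n ≥ N ≥ n − 2⌈log(2/δ)/ε⌉ contains no integer. *)

theory Defs
  imports "HOL-Probability.Probability"
begin

text \<open>
  A randomized algorithm with input set \<open>D\<close> and output space \<open>Y\<close> is represented by the family of
  its output distributions. No measurable structure is put on the inputs.
\<close>

definition randomized_algorithm :: "'a set \<Rightarrow> 'b measure \<Rightarrow> ('a \<Rightarrow> 'b measure) \<Rightarrow> bool" where
  "randomized_algorithm D Y M \<longleftrightarrow> M \<in> D \<rightarrow> space (prob_algebra Y)"

definition differentially_private ::
    "real \<Rightarrow> real \<Rightarrow> ('a \<Rightarrow> 'a \<Rightarrow> bool) \<Rightarrow> 'a set \<Rightarrow> 'b measure \<Rightarrow> ('a \<Rightarrow> 'b measure) \<Rightarrow> bool" where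
  "differentially_private \<epsilon> \<delta> nbr D Y M \<longleftrightarrow>
     (\<forall>x\<in>D. \<forall>x'\<in>D. nbr x x' \<longrightarrow>
        (\<forall>S\<in>sets Y. measure (M x) S \<le> exp \<epsilon> * measure (M x') S + \<delta>))"

definition tuples :: "'x set \<Rightarrow> nat \<Rightarrow> 'x list set" where
  "tuples X n = {x \<in> lists X. length x = n}"

definition replace_nbr :: "'x list \<Rightarrow> 'x list \<Rightarrow> bool" where
  "replace_nbr x x' \<longleftrightarrow> length x = length x' \<and> card {i. i < length x \<and> x ! i \<noteq> x' ! i} = 1"

definition add_nbr :: "'x list \<Rightarrow> 'x list \<Rightarrow> bool" where
  "add_nbr x x' \<longleftrightarrow> (\<exists>us a vs. x = us @ vs \<and> x' = us @ a # vs)"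

definition add_remove_replace_nbr :: "'x list \<Rightarrow> 'x list \<Rightarrow> bool" where
  "add_remove_replace_nbr x x' \<longleftrightarrow> add_nbr x x' \<or> add_nbr x' x \<or> replace_nbr x x'"

text \<open>
  The output space \<open>Y \<union> {\<bottom>}\<close>, with \<open>\<bottom>\<close> rendered as \<open>None\<close> and carrying the
  disjoint-union sigma-algebra.
\<close>

definition with_bot :: "'y measure \<Rightarrow> 'y option measure" where
  "with_bot Y = sigma (insert None (Some ` space Y)) (insert {None} ((`) Some ` sets Y))"

text \<open>
  The law of \<open>K s\<close> where \<open>s\<close> is drawn from \<open>p\<close> and the internal randomness of \<open>K\<close> is independent
  of \<open>s\<close>. Restricting \<open>p\<close> to its support makes values of \<open>K\<close> outside the support irrelevant;
  monadic bind on \<open>measure_pmf p\<close> itself would be meaningless if such a value were not a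
  subprobability measure.
\<close>

definition mixture :: "'s pmf \<Rightarrow> ('s \<Rightarrow> 'b measure) \<Rightarrow> 'b measure" where
  "mixture p K = restrict_space (measure_pmf p) (set_pmf p) \<bind> K"

lemma restrict_pmf_in_prob_algebra:
  "restrict_space (measure_pmf p) (set_pmf p) \<in> space (prob_algebra (count_space (set_pmf p)))"
proof -
  have "sets (restrict_space (measure_pmf p) (set_pmf p)) = sets (count_space (set_pmf p))"
    by (simp add: sets_restrict_space) blast
  moreover have "prob_space (restrict_space (measure_pmf p) (set_pmf p))"
    by (rule prob_space_restrict_space) (simp_all add: emeasure_pmf)
  ultimately show ?thesis
    by (simp add: space_prob_algebra)
qed

lemma
  assumes K: "\<And>s. s \<in> set_pmf p \<Longrightarrow> K s \<in> space (prob_algebra N)"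
  shows mixture_in_prob_algebra: "mixture p K \<in> space (prob_algebra N)"
    and measure_mixture: "S \<in> sets N \<Longrightarrow>
      measure (mixture p K) S = measure_pmf.expectation p (\<lambda>s. measure (K s) S)"
proof -
  let ?R = "restrict_space (measure_pmf p) (set_pmf p)"
  have R: "sets ?R = sets (count_space (set_pmf p))" "prob_space ?R"
    using restrict_pmf_in_prob_algebra[of p] by (auto simp: space_prob_algebra)
  have K1: "K \<in> count_space (set_pmf p) \<rightarrow>\<^sub>M prob_algebra N"
    using K by auto
  have K2: "K \<in> ?R \<rightarrow>\<^sub>M subprob_algebra N"
    using measurable_prob_algebraD[OF K1] measurable_cong_sets[OF R(1) refl] by blast
  show "mixture p K \<in> space (prob_algebra N)"
    unfolding mixture_def
    using measurable_space[OF measurable_bind_prob_space[OF measurable_const K1,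
        OF restrict_pmf_in_prob_algebra], of undefined "count_space UNIV"] by simp
  show "measure (mixture p K) S = measure_pmf.expectation p (\<lambda>s. measure (K s) S)"
    if S: "S \<in> sets N"
  proof -
    interpret prob_space ?R by (rule R(2))
    have "measure (mixture p K) S = (\<integral>s. measure (K s) S \<partial>?R)"
      unfolding mixture_def by (rule measure_bind[OF K2 S])
    also have "\<dots> = (\<integral>s. indicator (set_pmf p) s *\<^sub>R measure (K s) S \<partial>measure_pmf p)"
      by (rule integral_restrict_space) simp
    also have "\<dots> = measure_pmf.expectation p (\<lambda>s. measure (K s) S)"
      by (rule integral_cong_AE) (auto simp: AE_measure_pmf_iff)
    finally show ?thesis .
  qed
qed

text \<open>
  A uniformly random \<open>N\<close>-element set of indices in \<open>{..<n}\<close>, listed without repetition in some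
  (possibly random) order.
\<close>

definition uniform_index_sample :: "nat \<Rightarrow> nat \<Rightarrow> nat list pmf \<Rightarrow> bool" where
  "uniform_index_sample n N J \<longleftrightarrow>
     (\<forall>is\<in>set_pmf J. distinct is) \<and>
     map_pmf set J = pmf_of_set {I. I \<subseteq> {..<n} \<and> card I = N}"

definition subsample :: "'x list \<Rightarrow> nat list pmf \<Rightarrow> 'x list pmf" where
  "subsample x J = map_pmf (map (\<lambda>i. x ! i)) J"

text \<open>
  Given \<open>x\<close>, draw \<open>N\<close> from \<open>\<nu>\<close>; if \<open>N < n\<^sub>0\<close> (in particular if \<open>N < 0\<close>) output \<open>\<bottom>\<close>, otherwise
  run \<open>M\<^sub>N\<close> on the entries of \<open>x\<close> at the indices drawn from \<open>J N\<close>.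
\<close>

definition subsampled_algorithm ::
    "nat \<Rightarrow> 'y measure \<Rightarrow> (nat \<Rightarrow> 'x list \<Rightarrow> 'y measure) \<Rightarrow> int pmf \<Rightarrow> (nat \<Rightarrow> nat list pmf)
      \<Rightarrow> 'x list \<Rightarrow> 'y option measure" where
  "subsampled_algorithm n\<^sub>0 Y M \<nu> J x =
     mixture \<nu> (\<lambda>N.
       if N < int n\<^sub>0 then return (with_bot Y) None
       else mixture (subsample x (J (nat N)))
              (\<lambda>x'. distr (M (nat N) x') (with_bot Y) Some))"

end

theory Submission
  imports Defs "HOL-Combinatorics.Multiset_Permutations"
begin

text \<open>
  The sample size is \<open>N = n - k\<close>, where \<open>k\<close> has a discrete Laplace distribution centred at
  \<open>\<tau> = max 0 \<lceil>ln (2/\<delta>) / \<epsilon>\<rceil>\<close> and truncated to \<open>{0..2\<tau>}\<close>. The privacy loss splits into two parts.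

  Hiding the size: when \<open>n\<close> changes by one, the law of \<open>N\<close> is shifted by one. The weights of
  neighbouring values of \<open>k\<close> differ by a factor of at most \<open>exp \<epsilon>\<close>, so every probability
  changes by at most this factor, apart from the one end point that leaves the support; and
  \<open>\<tau>\<close> is large enough for that point to have mass at most \<open>\<delta>\<close>
  (\<open>truncated_discrete_laplace_exists\<close>).

  Hiding the element: for fixed \<open>N\<close>, the samples from \<open>x\<close> and from \<open>x'\<close>, which has one more
  element \<open>a\<close>, can be coupled so that they differ in at most one position. Take a uniformly random
  sample that avoids the position of \<open>a\<close> and swap \<open>a\<close> with a uniformly random element of \<open>x'\<close>;
  the result is a uniformly random sample from \<open>x'\<close>
  (\<open>expectation_arrangements_transpose\<close>). Samples are listed in random order: for
  sorted samples the swap would also move the other entries of the list. Replacement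
  privacy of \<open>M\<^sub>N\<close> then gives \<open>(\<epsilon>, \<delta>)\<close>-closeness for each \<open>N\<close>
  (\<open>arranged_mean_add\<close>, \<open>arranged_mean_replace\<close>).

  The two parts compose additively (\<open>expectation_dominance_compose\<close>). The event \<open>N < n\<^sub>0\<close>
  costs nothing extra, since on it the output is \<open>\<bottom>\<close> for both inputs.
\<close>

section \<open>The output space with a failure symbol\<close>

lemma with_bot_generators: "insert {None} ((`) Some ` sets Y) \<subseteq> Pow (insert None (Some ` space Y))"
  by (auto dest: sets.sets_into_space)

lemma space_with_bot [simp]: "space (with_bot Y) = insert None (Some ` space Y)"
  unfolding with_bot_def by (rule space_measure_of[OF with_bot_generators])

lemma sets_with_bot: "sets (with_bot Y)
    = sigma_sets (insert None (Some ` space Y)) (insert {None} ((`) Some ` sets Y))"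
  unfolding with_bot_def by (rule sets_measure_of[OF with_bot_generators])

lemma measurable_Some [measurable]: "Some \<in> Y \<rightarrow>\<^sub>M with_bot Y"
proof (rule measurable_sigma_sets[OF sets_with_bot with_bot_generators])
  show "Some \<in> space Y \<rightarrow> insert None (Some ` space Y)"
    by auto
next
  fix A assume "A \<in> insert {None} ((`) Some ` sets Y)"
  then consider "A = {None}" | B where "A = Some ` B" "B \<in> sets Y"
    by auto
  then show "Some -` A \<inter> space Y \<in> sets Y"
  proof cases
    case 1
    then have "Some -` A \<inter> space Y = {}" by auto
    then show ?thesis by simp
  next
    case 2
    then have "Some -` A \<inter> space Y = B"
      by (auto dest: sets.sets_into_space)
    then show ?thesis using 2 by simp
  qed
qed

lemma return_None_in_prob_algebra:
  "return (with_bot Y) None \<in> space (prob_algebra (with_bot Y))"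
  by (auto simp: space_prob_algebra intro: prob_space_return)

lemma distr_Some_in_prob_algebra:
  assumes "P \<in> space (prob_algebra Y)"
  shows "distr P (with_bot Y) Some \<in> space (prob_algebra (with_bot Y))"
proof -
  have "Some \<in> P \<rightarrow>\<^sub>M with_bot Y"
    using assms measurable_Some measurable_cong_sets[of P Y] by (auto simp: space_prob_algebra)
  then show ?thesis
    using assms by (auto simp: space_prob_algebra intro: prob_space.prob_space_distr)
qed

lemma measure_distr_Some:
  assumes "P \<in> space (prob_algebra Y)" "S \<in> sets (with_bot Y)"
  shows "measure (distr P (with_bot Y) Some) S = measure P (Some -` S \<inter> space Y)"
proof -
  have P: "sets P = sets Y"
    using assms by (auto simp: space_prob_algebra)
  then have "Some \<in> P \<rightarrow>\<^sub>M with_bot Y"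
    using measurable_Some measurable_cong_sets[of P Y] by auto
  then show ?thesis
    using assms(2) sets_eq_imp_space_eq[OF P] by (simp add: measure_distr)
qed

section \<open>A truncated discrete Laplace distribution\<close>

text \<open>
  The weights are \<open>exp (- \<epsilon> \<bar>k - \<tau>\<bar>)\<close>. The central weight is 1, so the normalizing constant is
  at least 1 and dividing by it only lowers the two end weights \<open>exp (- \<epsilon> \<tau>)\<close>.
\<close>

lemma truncated_discrete_laplace_exists:
  fixes \<epsilon> :: real and \<tau> :: int
  assumes "\<epsilon> > 0" "\<tau> \<ge> 0"
  obtains q :: "int pmf" where
    "set_pmf q = {0..2*\<tau>}"
    "\<And>j k. \<lbrakk>j \<in> {0..2*\<tau>}; k \<in> {0..2*\<tau>}; \<bar>j - k\<bar> \<le> 1\<rbrakk> \<Longrightarrow> pmf q j \<le> exp \<epsilon> * pmf q k"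
    "pmf q 0 \<le> exp (- \<epsilon> * \<tau>)" "pmf q (2*\<tau>) \<le> exp (- \<epsilon> * \<tau>)"
proof -
  define w :: "int \<Rightarrow> real" where "w k = exp (- \<epsilon> * \<bar>k - \<tau>\<bar>)" for k
  define Z where "Z = (\<Sum>k\<in>{0..2*\<tau>}. w k)"
  have "w \<tau> \<le> Z"
    unfolding Z_def by (rule member_le_sum) (use assms in \<open>auto simp: w_def\<close>)
  then have Z: "Z \<ge> 1"
    by (simp add: w_def)
  define f where "f k = (if k \<in> {0..2*\<tau>} then w k / Z else 0)" for k
  define q where "q = embed_pmf f"
  have nonneg: "f k \<ge> 0" for k
    using Z by (simp add: f_def w_def)
  have "(\<integral>\<^sup>+k. ennreal (f k) \<partial>count_space UNIV) = (\<Sum>k\<in>{0..2*\<tau>}. ennreal (f k))"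
    by (rule nn_integral_count_space') (auto simp: f_def)
  also have "\<dots> = ennreal (\<Sum>k\<in>{0..2*\<tau>}. f k)"
    using nonneg by (simp add: sum_ennreal)
  also have "(\<Sum>k\<in>{0..2*\<tau>}. f k) = 1"
    using Z by (simp add: f_def Z_def flip: sum_divide_distrib)
  finally have total: "(\<integral>\<^sup>+k. ennreal (f k) \<partial>count_space UNIV) = 1"
    by simp
  have pmf: "pmf q k = f k" for k
    unfolding q_def by (rule pmf_embed_pmf[OF nonneg total])
  show thesis
  proof (rule that)
    show "set_pmf q = {0..2*\<tau>}"
      using Z by (auto simp: set_pmf_eq pmf f_def w_def)
    show "pmf q j \<le> exp \<epsilon> * pmf q k"
      if "j \<in> {0..2*\<tau>}" "k \<in> {0..2*\<tau>}" "\<bar>j - k\<bar> \<le> 1" for j k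
    proof -
      have "\<bar>k - \<tau>\<bar> \<le> \<bar>j - \<tau>\<bar> + 1"
        using that by linarith
      then have "real_of_int \<bar>k - \<tau>\<bar> \<le> \<bar>j - \<tau>\<bar> + 1"
        by linarith
      then have "\<epsilon> * real_of_int \<bar>k - \<tau>\<bar> \<le> \<epsilon> * (\<bar>j - \<tau>\<bar> + 1)"
        using assms by (intro mult_left_mono) auto
      then have "w j \<le> exp \<epsilon> * w k"
        by (simp add: w_def algebra_simps flip: exp_add)
      then show ?thesis
        using Z that by (simp add: pmf f_def divide_right_mono)
    qed
    have "exp (- \<epsilon> * \<tau>) / Z \<le> exp (- \<epsilon> * \<tau>)"
      using Z by (simp add: divide_le_eq)
    then show "pmf q 0 \<le> exp (- \<epsilon> * \<tau>)" "pmf q (2*\<tau>) \<le> exp (- \<epsilon> * \<tau>)"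
      using assms by (auto simp: pmf f_def w_def)
  qed
qed

section \<open>Mixing over a random sample size\<close>

text \<open>
  The composition step: \<open>p\<close> and \<open>q\<close> are the laws of the sample size for two neighbouring inputs,
  \<open>f\<close> and \<open>g\<close> the conditional probabilities of an output event, and \<open>b\<close> the end point of the
  support of \<open>p\<close> that \<open>q\<close> may miss. The error \<open>\<delta>\<close> is weighted by \<open>p\<close> before \<open>p\<close> is replaced by
  \<open>c * q\<close>; in the other order it would be multiplied by \<open>c\<close>.
\<close>

lemma expectation_dominance_compose:
  fixes p q :: "'a pmf" and f g :: "'a \<Rightarrow> real"
  assumes fin: "finite (set_pmf p)" "finite (set_pmf q)"
    and nonneg: "c \<ge> 0" "c' \<ge> 0" "\<delta> \<ge> 0" "\<And>N. g N \<ge> 0"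
    and f: "\<And>N. N \<in> set_pmf p \<Longrightarrow> f N \<in> {0..1}"
    and pq: "\<And>N. \<lbrakk>N \<in> set_pmf p; N \<noteq> b\<rbrakk> \<Longrightarrow> pmf p N \<le> c * pmf q N"
    and fg: "\<And>N. \<lbrakk>N \<in> set_pmf p; N \<noteq> b\<rbrakk> \<Longrightarrow> f N \<le> c' * g N + \<delta>"
    and b: "pmf p b \<le> \<delta>'"
  shows "measure_pmf.expectation p f \<le> c * c' * measure_pmf.expectation q g + (\<delta> + \<delta>')"
proof -
  define A where "A = insert b (set_pmf p \<union> set_pmf q)"
  have A: "finite A" "set_pmf p \<subseteq> A" "set_pmf q \<subseteq> A" "b \<in> A"
    using fin by (auto simp: A_def)
  have "\<delta>' \<ge> 0"
    using b pmf_nonneg[of p b] by linarith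
  have step: "f N * pmf p N \<le> c * c' * (g N * pmf q N) + (\<delta> * pmf p N + (if N = b then \<delta>' else 0))"
    (is "_ \<le> ?main + ?err") for N
  proof (cases "N \<in> set_pmf p")
    case False
    then show ?thesis
      using nonneg \<open>\<delta>' \<ge> 0\<close> by (simp add: set_pmf_iff)
  next
    case True
    have main: "?main \<ge> 0"
      using nonneg by simp
    show ?thesis
    proof (cases "N = b")
      case True
      have "f N * pmf p N \<le> 1 * \<delta>'"
        using b f[OF \<open>N \<in> set_pmf p\<close>] True by (intro mult_mono) auto
      then show ?thesis
        using main nonneg True by (simp add: add_increasing)
    next
      case False
      have "f N * pmf p N \<le> (c' * g N + \<delta>) * pmf p N"
        using fg[OF True False] by (intro mult_right_mono) auto
      also have "\<dots> = c' * g N * pmf p N + \<delta> * pmf p N"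
        by (simp add: algebra_simps)
      also have "c' * g N * pmf p N \<le> c' * g N * (c * pmf q N)"
        using pq[OF True False] nonneg by (intro mult_left_mono) auto
      finally show ?thesis
        using False by (simp add: mult_ac)
    qed
  qed
  have E: "measure_pmf.expectation r h = (\<Sum>N\<in>A. h N * pmf r N)"
    if "set_pmf r \<subseteq> A" for r and h :: "'a \<Rightarrow> real"
    by (rule integral_measure_pmf_real[OF A(1)]) (use that in auto)
  have "(\<Sum>N\<in>A. f N * pmf p N)
      \<le> (\<Sum>N\<in>A. c * c' * (g N * pmf q N) + (\<delta> * pmf p N + (if N = b then \<delta>' else 0)))"
    by (intro sum_mono step)
  also have "\<dots> = c * c' * (\<Sum>N\<in>A. g N * pmf q N) + (\<delta> * (\<Sum>N\<in>A. pmf p N) + \<delta>')"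
    using A by (simp add: sum.distrib sum_distrib_left)
  also have "(\<Sum>N\<in>A. pmf p N) = 1"
    using A by (intro sum_pmf_eq_1) auto
  finally show ?thesis
    using A by (simp add: E)
qed

section \<open>Uniform sampling without replacement in random order\<close>

definition arrangements :: "'a set \<Rightarrow> nat \<Rightarrow> 'a list set" where
  "arrangements A N = {is. distinct is \<and> set is \<subseteq> A \<and> length is = N}"

lemma finite_arrangements [simp]: "finite A \<Longrightarrow> finite (arrangements A N)"
  by (rule finite_subset[OF _ finite_lists_length_eq[of A N]]) (auto simp: arrangements_def)

lemma arrangements_nonempty:
  assumes "finite A" "N \<le> card A"
  shows "arrangements A N \<noteq> {}"
proof -
  obtain I where "I \<subseteq> A" "card I = N" "finite I"
    using obtain_subset_with_card_n[OF assms(2)] by blast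
  then obtain "is" where "set is = I" "distinct is"
    using finite_distinct_list by blast
  with \<open>I \<subseteq> A\<close> \<open>card I = N\<close> have "is \<in> arrangements A N"
    by (auto simp: arrangements_def distinct_card)
  then show ?thesis by blast
qed

lemma set_pmf_arrangements:
  "\<lbrakk>finite A; N \<le> card A\<rbrakk> \<Longrightarrow> set_pmf (pmf_of_set (arrangements A N)) = arrangements A N"
  by (simp add: arrangements_nonempty)

text \<open>
  Every set of size \<open>N\<close> has the same number \<open>N!\<close> of orderings, so forgetting the order of a
  uniform arrangement leaves a uniform set.
\<close>

lemma uniform_index_sample_arrangements:
  assumes "N \<le> n"
  shows "uniform_index_sample n N (pmf_of_set (arrangements {..<n} N))"
proof -
  let ?I = "{I. I \<subseteq> {..<n} \<and> card I = N}"
  have I: "finite ?I" "?I \<noteq> {}"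
    using obtain_subset_with_card_n[of N "{..<n}"] assms by auto
  have finI: "finite I" if "I \<in> ?I" for I
    using that finite_subset by auto
  have UN: "arrangements {..<n} N = (\<Union>I\<in>?I. permutations_of_set I)"
    by (auto simp: arrangements_def permutations_of_set_def distinct_card)
  have "pmf_of_set (arrangements {..<n} N)
      = pmf_of_set ?I \<bind> (\<lambda>I. pmf_of_set (permutations_of_set I))"
    unfolding UN
  proof (rule pmf_of_set_UN)
    show "finite (\<Union>I\<in>?I. permutations_of_set I)"
      by (simp flip: UN)
    show "disjoint_family_on permutations_of_set ?I"
      by (auto simp: disjoint_family_on_def permutations_of_set_def)
    show "card (permutations_of_set I) = fact N" if "I \<in> ?I" for I
      using finI[OF that] that by simp
    show "permutations_of_set I \<noteq> {}" if "I \<in> ?I" for I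
      using finI[OF that] by simp
  qed (rule I(2))
  then have "map_pmf set (pmf_of_set (arrangements {..<n} N))
      = pmf_of_set ?I \<bind> (\<lambda>I. map_pmf set (pmf_of_set (permutations_of_set I)))"
    by (simp only: map_bind_pmf)
  also have "\<dots> = pmf_of_set ?I \<bind> return_pmf"
  proof (rule bind_pmf_cong[OF refl])
    fix I assume "I \<in> set_pmf (pmf_of_set ?I)"
    then have "finite I"
      unfolding set_pmf_of_set[OF I(2,1)] by (rule finI)
    then have "map_pmf set (pmf_of_set (permutations_of_set I))
        = map_pmf (\<lambda>_. I) (pmf_of_set (permutations_of_set I))"
      by (intro map_pmf_cong) (auto simp: permutations_of_setD)
    then show "map_pmf set (pmf_of_set (permutations_of_set I)) = return_pmf I"
      by (simp add: map_pmf_const)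
  qed
  finally have "map_pmf set (pmf_of_set (arrangements {..<n} N)) = pmf_of_set ?I"
    by (simp add: bind_return_pmf')
  moreover have "distinct is" if "is \<in> set_pmf (pmf_of_set (arrangements {..<n} N))" for "is"
    using that assms by (simp add: set_pmf_arrangements) (simp add: arrangements_def)
  ultimately show ?thesis
    by (simp add: uniform_index_sample_def)
qed

lemma bij_betw_arrangements:
  assumes "bij_betw s A B"
  shows "bij_betw (map s) (arrangements A N) (arrangements B N)"
proof (rule bij_betw_byWitness[where f' = "map (the_inv_into A s)"])
  have inj: "inj_on s A" and im: "s ` A = B"
    using assms by (auto simp: bij_betw_def)
  show "\<forall>is\<in>arrangements A N. map (the_inv_into A s) (map s is) = is"
    by (auto simp: arrangements_def subset_iff the_inv_into_f_f[OF inj] intro!: map_idI)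
  show "\<forall>is\<in>arrangements B N. map s (map (the_inv_into A s) is) = is"
    using im by (auto simp: arrangements_def subset_iff f_the_inv_into_f[OF inj] intro!: map_idI)
  show "map s ` arrangements A N \<subseteq> arrangements B N"
    using im by (force simp: arrangements_def distinct_map intro: inj_on_subset[OF inj])
  show "map (the_inv_into A s) ` arrangements B N \<subseteq> arrangements A N"
    using im bij_betw_the_inv_into[OF assms]
    by (fastforce simp: arrangements_def distinct_map bij_betw_def intro: inj_on_subset)
qed

text \<open>
  A double count. Swapping \<open>p\<close> with \<open>l\<close> is an involution, and \<open>js\<close> arises from a list avoiding
  \<open>p\<close> by swapping with \<open>l\<close> exactly when \<open>l\<close> is not an entry of \<open>js\<close>, whether or not \<open>p\<close> is one.
  So every \<open>js\<close> is hit \<open>card A - N\<close> times.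
\<close>

lemma sum_arrangements_transpose:
  fixes h :: "'a list \<Rightarrow> real"
  assumes "finite A" "p \<in> A"
  shows "(\<Sum>is\<in>arrangements (A - {p}) N. \<Sum>l\<in>A. h (map (Transposition.transpose p l) is))
    = real (card A - N) * (\<Sum>js\<in>arrangements A N. h js)"
proof -
  have "(\<Sum>is\<in>arrangements (A - {p}) N. \<Sum>l\<in>A. h (map (Transposition.transpose p l) is))
      = (\<Sum>(is, l)\<in>arrangements (A - {p}) N \<times> A. h (map (Transposition.transpose p l) is))"
    by (rule sum.cartesian_product)
  also have "\<dots> = (\<Sum>(js, l)\<in>(SIGMA js:arrangements A N. A - set js). h js)"
  proof (rule sum.reindex_bij_witness[where
        i = "\<lambda>(js, l). (map (Transposition.transpose p l) js, l)" and j = "\<lambda>(is, l). (map (Transposition.transpose p l) is, l)"])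
    fix a assume "a \<in> arrangements (A - {p}) N \<times> A"
    then show "(case a of (is, l) \<Rightarrow> (map (Transposition.transpose p l) is, l)) \<in> (SIGMA js:arrangements A N. A - set js)"
      using assms by (auto simp: arrangements_def distinct_map Transposition.transpose_def)
  next
    fix b assume "b \<in> (SIGMA js:arrangements A N. A - set js)"
    then show "(case b of (js, l) \<Rightarrow> (map (Transposition.transpose p l) js, l)) \<in> arrangements (A - {p}) N \<times> A"
      using assms by (auto simp: arrangements_def distinct_map Transposition.transpose_def)
  qed (auto simp: comp_def)
  also have "\<dots> = (\<Sum>js\<in>arrangements A N. \<Sum>l\<in>A - set js. h js)"
    using assms by (intro sum.Sigma[symmetric]) auto
  also have "\<dots> = (\<Sum>js\<in>arrangements A N. real (card A - N) * h js)"
    using assms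
    by (intro sum.cong refl) (auto simp: arrangements_def card_Diff_subset distinct_card)
  finally show ?thesis
    by (simp add: sum_distrib_left)
qed

text \<open>
  Since the multiplicity in the double count does not depend on the arrangement, swapping \<open>p\<close>
  with a uniform element turns a uniform arrangement that avoids \<open>p\<close> into a uniform arrangement
  of the whole set. This is the coupling between the samples from \<open>x\<close> and from \<open>x'\<close>.
\<close>

lemma expectation_arrangements_transpose:
  fixes h :: "'a list \<Rightarrow> real"
  assumes "finite A" "p \<in> A" "N < card A"
  shows "measure_pmf.expectation (pmf_of_set (arrangements A N)) h
    = measure_pmf.expectation (pmf_of_set (arrangements (A - {p}) N))
        (\<lambda>is. measure_pmf.expectation (pmf_of_set A) (\<lambda>l. h (map (Transposition.transpose p l) is)))"
proof -
  let ?B = "arrangements (A - {p}) N" and ?C = "arrangements A N"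
  have ne: "?B \<noteq> {}" "?C \<noteq> {}" "A \<noteq> {}"
    using assms arrangements_nonempty[of "A - {p}" N] arrangements_nonempty[of A N]
    by (auto simp: card_Diff_singleton)
  \<comment> \<open>The double count for the constant function 1 identifies the normalizing factors.\<close>
  have "real (card ?B) * real (card A) = real (card A - N) * real (card ?C)"
    using sum_arrangements_transpose[OF assms(1,2), of "\<lambda>_. 1" N] by simp
  moreover have "card ?B > 0" "card ?C > 0" "card A > 0" "card A - N > 0"
    using assms ne by (auto simp: card_gt_0_iff)
  moreover have "(\<Sum>is\<in>?B. (\<Sum>l\<in>A. h (map (Transposition.transpose p l) is)) / card A) / card ?B
      = real (card A - N) * (\<Sum>js\<in>?C. h js) / (real (card ?B) * real (card A))"
    by (simp add: sum_arrangements_transpose[OF assms(1,2)] mult.commute flip: sum_divide_distrib)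
  ultimately have "(\<Sum>is\<in>?B. (\<Sum>l\<in>A. h (map (Transposition.transpose p l) is)) / card A) / card ?B
      = (\<Sum>js\<in>?C. h js) / card ?C"
    by simp
  then show ?thesis
    using assms ne by (simp add: integral_pmf_of_set mult.commute flip: sum_divide_distrib)
qed

section \<open>Privacy of the subsample of a given size\<close>

text \<open>
  Two data sets that disagree only at the index \<open>l\<close> give equal samples or replacement neighbours,
  because a sample without repetition uses \<open>l\<close> at most once. Equality has to be listed
  separately: \<open>replace_nbr\<close> demands exactly one differing entry.
\<close>

lemma map_eq_or_replace_nbr:
  assumes "distinct is" and eq: "\<And>i. \<lbrakk>i \<in> set is; i \<noteq> l\<rbrakk> \<Longrightarrow> u i = v i"
  shows "map u is = map v is \<or> replace_nbr (map u is) (map v is)"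
proof (cases "map u is = map v is")
  case False
  let ?D = "{k. k < length is \<and> u (is ! k) \<noteq> v (is ! k)}"
  obtain k where k: "k \<in> ?D"
    using False by (auto simp: list_eq_iff_nth_eq)
  have "?D = {k}"
    using k eq assms(1) by (auto simp: nth_eq_iff_index_eq) (metis nth_eq_iff_index_eq nth_mem)
  moreover have "{k. k < length (map u is) \<and> map u is ! k \<noteq> map v is ! k} = ?D"
    by auto
  ultimately show ?thesis
    by (simp add: replace_nbr_def)
qed simp

lemma expectation_mono_affine:
  fixes f g :: "'a \<Rightarrow> real"
  assumes "finite (set_pmf p)" "\<And>x. x \<in> set_pmf p \<Longrightarrow> f x \<le> c * g x + d"
  shows "measure_pmf.expectation p f \<le> c * measure_pmf.expectation p g + d"
proof -
  have int: "integrable (measure_pmf p) h" for h :: "'a \<Rightarrow> real"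
    by (rule integrable_measure_pmf_finite[OF assms(1)])
  have "measure_pmf.expectation p f \<le> measure_pmf.expectation p (\<lambda>x. c * g x + d)"
    using assms(2) by (intro integral_mono_AE int) (auto simp: AE_measure_pmf_iff)
  also have "\<dots> = c * measure_pmf.expectation p g + d"
    using int by (subst Bochner_Integration.integral_add) auto
  finally show ?thesis .
qed

definition arranged_mean :: "nat \<Rightarrow> ('x list \<Rightarrow> real) \<Rightarrow> 'x list \<Rightarrow> real" where
  "arranged_mean N h x =
     measure_pmf.expectation (pmf_of_set (arrangements {..<length x} N)) (\<lambda>is. h (map ((!) x) is))"

lemma arranged_in_tuples:
  assumes "x \<in> lists X" "is \<in> arrangements {..<length x} N"
  shows "map ((!) x) is \<in> tuples X N"
  using assms by (auto simp: tuples_def arrangements_def subset_iff in_lists_conv_set)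

lemma arranged_mean_replace:
  assumes nbr: "replace_nbr x x'" and x: "x \<in> lists X" "x' \<in> lists X" and N: "N \<le> length x"
    and h: "\<And>y y'. \<lbrakk>y \<in> tuples X N; y' \<in> tuples X N; y = y' \<or> replace_nbr y y'\<rbrakk> \<Longrightarrow> h y \<le> c * h y' + d"
  shows "arranged_mean N h x \<le> c * arranged_mean N h x' + d"
proof -
  have len: "length x' = length x"
    using nbr by (simp add: replace_nbr_def)
  obtain p where "{i. i < length x \<and> x ! i \<noteq> x' ! i} = {p}"
    using nbr by (auto simp: replace_nbr_def card_1_singleton_iff)
  then have p: "x ! i = x' ! i" if "i < length x" "i \<noteq> p" for i
    using that by blast
  show ?thesis
    unfolding arranged_mean_def len
  proof (rule expectation_mono_affine)
    fix "is" assume "is \<in> set_pmf (pmf_of_set (arrangements {..<length x} N))"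
    then have is_mem: "is \<in> arrangements {..<length x} N"
      using N by (simp add: set_pmf_arrangements)
    then have "map ((!) x) is = map ((!) x') is \<or> replace_nbr (map ((!) x) is) (map ((!) x') is)"
      using p by (intro map_eq_or_replace_nbr[where l = p]) (auto simp: arrangements_def)
    then show "h (map ((!) x) is) \<le> c * h (map ((!) x') is) + d"
      using is_mem x len arranged_in_tuples[of x X "is" N] arranged_in_tuples[of x' X "is" N]
      by (intro h) auto
  qed (use N in \<open>simp add: set_pmf_arrangements\<close>)
qed

text \<open>
  Expresses sampling from the smaller data set by indices into the larger one, so that the samples
  from both can be compared on a common index set.
\<close>

lemma arranged_mean_delete:
  assumes "N \<le> length (us @ vs)"
  shows "arranged_mean N h (us @ vs) = measure_pmf.expectation
    (pmf_of_set (arrangements ({..<length (us @ a # vs)} - {length us}) N))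
    (\<lambda>is. h (map ((!) (us @ a # vs)) is))"
proof -
  define s where "s i = (if i < length us then i else Suc i)" for i
  let ?A = "{..<length (us @ vs)}" and ?B = "{..<length (us @ a # vs)} - {length us}"
  have s: "bij_betw s ?A ?B"
    by (rule bij_betw_byWitness[where f' = "\<lambda>i. if i < length us then i else i - 1"])
      (auto simp: s_def)
  have reindex: "map_pmf (map s) (pmf_of_set (arrangements ?A N)) = pmf_of_set (arrangements ?B N)"
    using assms by (intro map_pmf_of_set_bij_betw bij_betw_arrangements s arrangements_nonempty) auto
  have "measure_pmf.expectation (pmf_of_set (arrangements ?B N)) (\<lambda>is. h (map ((!) (us @ a # vs)) is))
      = measure_pmf.expectation (pmf_of_set (arrangements ?A N))
          (\<lambda>is. h (map ((!) (us @ a # vs)) (map s is)))"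
    unfolding reindex[symmetric] by (rule integral_map_pmf)
  moreover have "map ((!) (us @ a # vs)) (map s is) = map ((!) (us @ vs)) is" for "is"
    by (auto simp: s_def nth_append Suc_diff_le)
  ultimately show ?thesis
    by (simp only: arranged_mean_def)
qed

text \<open>
  With \<open>p\<close> the position of the added element, a sample \<open>is\<close> that avoids \<open>p\<close> is compared with its
  image under the swap of \<open>p\<close> and \<open>l\<close>, which differs from it at most where \<open>l\<close> was listed. The
  hypothesis on \<open>h\<close> is symmetric in the two samples, so both directions follow by
  averaging over \<open>is\<close> and \<open>l\<close>.
\<close>

lemma arranged_mean_add:
  assumes nbr: "add_nbr x x'" and x: "x' \<in> lists X" and N: "N \<le> length x"
    and h: "\<And>y y'. \<lbrakk>y \<in> tuples X N; y' \<in> tuples X N; y = y' \<or> replace_nbr y y'\<rbrakk> \<Longrightarrow> h y \<le> c * h y' + d"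
  shows "arranged_mean N h x \<le> c * arranged_mean N h x' + d"
    and "arranged_mean N h x' \<le> c * arranged_mean N h x + d"
proof -
  obtain us a vs where uv: "x = us @ vs" "x' = us @ a # vs"
    using nbr by (auto simp: add_nbr_def)
  define p where "p = length us"
  let ?A = "{..<length x'}"
  define P where "P = pmf_of_set (arrangements (?A - {p}) N)"
  define Q where "Q = pmf_of_set ?A"
  have p: "p \<in> ?A" "N < card ?A" "N \<le> card (?A - {p})"
    using N by (auto simp: uv p_def)
  have finP: "finite (set_pmf P)" and setP: "set_pmf P = arrangements (?A - {p}) N"
    unfolding P_def using p by (auto simp: set_pmf_arrangements)
  have finQ: "finite (set_pmf Q)" and setQ: "set_pmf Q = ?A"
    unfolding Q_def using p by (subst set_pmf_of_set; auto)+
  let ?f = "\<lambda>is. h (map ((!) x') is)" and ?g = "\<lambda>is l. h (map ((!) x') (map (Transposition.transpose p l) is))"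
  have E: "arranged_mean N h x = measure_pmf.expectation P ?f"
    using arranged_mean_delete[of N us vs h a] N by (simp add: uv P_def p_def)
  have E': "arranged_mean N h x' = measure_pmf.expectation P (\<lambda>is. measure_pmf.expectation Q (?g is))"
    unfolding arranged_mean_def P_def Q_def
    by (rule expectation_arrangements_transpose) (use p in auto)
  have nbr: "?f is \<le> c * ?g is l + d" "?g is l \<le> c * ?f is + d"
    if "is \<in> set_pmf P" "l \<in> set_pmf Q" for "is" l
  proof -
    let ?js = "map (Transposition.transpose p l) is"
    have "is": "is \<in> arrangements ?A N" "p \<notin> set is"
      using that by (auto simp: setP arrangements_def)
    then have "?js \<in> arrangements ?A N"
      using that p by (auto simp: setQ arrangements_def distinct_map Transposition.transpose_def)
    then have mem: "map ((!) x') is \<in> tuples X N" "map ((!) x') ?js \<in> tuples X N"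
      using "is" by (auto intro!: arranged_in_tuples[OF x] simp del: map_map)
    have "distinct is"
      using "is" by (simp add: arrangements_def)
    then have "map ((!) x') is = map ((!) x' \<circ> Transposition.transpose p l) is \<or>
        replace_nbr (map ((!) x') is) (map ((!) x' \<circ> Transposition.transpose p l) is)"
      "map ((!) x' \<circ> Transposition.transpose p l) is = map ((!) x') is \<or>
        replace_nbr (map ((!) x' \<circ> Transposition.transpose p l) is) (map ((!) x') is)"
      by (rule map_eq_or_replace_nbr[where l = l];
          use "is" in \<open>auto simp: Transposition.transpose_def\<close>)+
    then show "?f is \<le> c * ?g is l + d" "?g is l \<le> c * ?f is + d"
      unfolding map_map[symmetric] using mem by (blast intro: h)+
  qed
  show "arranged_mean N h x' \<le> c * arranged_mean N h x + d"
    unfolding E E'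
  proof (rule expectation_mono_affine[OF finP])
    fix "is" assume "is \<in> set_pmf P"
    then have "measure_pmf.expectation Q (?g is) \<le> c * measure_pmf.expectation Q (\<lambda>_. ?f is) + d"
      by (intro expectation_mono_affine[OF finQ] nbr)
    then show "measure_pmf.expectation Q (?g is) \<le> c * ?f is + d"
      by simp
  qed
  show "arranged_mean N h x \<le> c * arranged_mean N h x' + d"
    unfolding E E'
  proof (rule expectation_mono_affine[OF finP])
    fix "is" assume "is \<in> set_pmf P"
    then have "measure_pmf.expectation Q (\<lambda>_. ?f is) \<le> c * measure_pmf.expectation Q (?g is) + d"
      by (intro expectation_mono_affine[OF finQ] nbr)
    then show "?f is \<le> c * measure_pmf.expectation Q (?g is) + d"
      by simp
  qed
qed

section \<open>The subsampled algorithm\<close>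

lemma subsampled_algorithm_arrangements:
  assumes M: "\<And>n. n \<ge> n\<^sub>0 \<Longrightarrow> randomized_algorithm (tuples X n) Y (M n)"
    and x: "x \<in> lists X" and \<nu>: "\<And>N. N \<in> set_pmf \<nu> \<Longrightarrow> N \<le> int (length x)"
  defines "K \<equiv> subsampled_algorithm n\<^sub>0 Y M \<nu> (\<lambda>N. pmf_of_set (arrangements {..<length x} N)) x"
  shows "K \<in> space (prob_algebra (with_bot Y))"
    and "S \<in> sets (with_bot Y) \<Longrightarrow> measure K S = measure_pmf.expectation \<nu>
      (\<lambda>N. if N < int n\<^sub>0 then indicator S None
           else arranged_mean (nat N) (\<lambda>y. measure (M (nat N) y) (Some -` S \<inter> space Y)) x)"
proof -
  define J where "J N = pmf_of_set (arrangements {..<length x} N)" for N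
  define L where "L N = (if N < int n\<^sub>0 then return (with_bot Y) None
       else mixture (subsample x (J (nat N))) (\<lambda>x'. distr (M (nat N) x') (with_bot Y) Some))" for N
  have K: "K = mixture \<nu> L"
    unfolding K_def J_def L_def[abs_def] subsampled_algorithm_def ..
  have M_in: "M (nat N) y \<in> space (prob_algebra Y)"
    if "N \<in> set_pmf \<nu>" "\<not> N < int n\<^sub>0" "y \<in> set_pmf (subsample x (J (nat N)))" for N y
  proof -
    have "y \<in> tuples X (nat N)"
      using that \<nu>[OF that(1)] x
      by (auto simp: subsample_def J_def set_pmf_arrangements intro!: arranged_in_tuples)
    then show ?thesis
      using M[of "nat N"] that(2) by (auto simp: randomized_algorithm_def nat_le_iff le_nat_iff)
  qed
  have L: "L N \<in> space (prob_algebra (with_bot Y))" if "N \<in> set_pmf \<nu>" for N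
  proof (cases "N < int n\<^sub>0")
    case True
    then show ?thesis
      by (simp add: L_def return_None_in_prob_algebra)
  next
    case False
    have "mixture (subsample x (J (nat N))) (\<lambda>x'. distr (M (nat N) x') (with_bot Y) Some)
        \<in> space (prob_algebra (with_bot Y))"
      by (intro mixture_in_prob_algebra distr_Some_in_prob_algebra M_in[OF that False])
    then show ?thesis
      using False by (simp add: L_def)
  qed
  then show "K \<in> space (prob_algebra (with_bot Y))"
    unfolding K by (rule mixture_in_prob_algebra)
  assume S: "S \<in> sets (with_bot Y)"
  have measL: "measure (L N) S = (if N < int n\<^sub>0 then indicator S None
      else arranged_mean (nat N) (\<lambda>y. measure (M (nat N) y) (Some -` S \<inter> space Y)) x)"
    if N: "N \<in> set_pmf \<nu>" for N
  proof (cases "N < int n\<^sub>0")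
    case True
    then show ?thesis
      using S by (simp add: L_def measure_return)
  next
    case False
    have "measure (L N) S = measure_pmf.expectation (subsample x (J (nat N)))
        (\<lambda>y. measure (distr (M (nat N) y) (with_bot Y) Some) S)"
      using False M_in[OF N False] S
      by (simp add: L_def measure_mixture[OF distr_Some_in_prob_algebra])
    also have "\<dots> = measure_pmf.expectation (subsample x (J (nat N)))
        (\<lambda>y. measure (M (nat N) y) (Some -` S \<inter> space Y))"
      using M_in[OF N False] S
      by (intro integral_cong_AE) (auto simp: AE_measure_pmf_iff measure_distr_Some)
    finally show ?thesis
      using False by (simp add: arranged_mean_def J_def subsample_def)
  qed
  have "measure K S = measure_pmf.expectation \<nu> (\<lambda>N. measure (L N) S)"
    unfolding K by (rule measure_mixture[OF L S])
  also have "\<dots> = measure_pmf.expectation \<nu> (\<lambda>N. if N < int n\<^sub>0 then indicator S None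
      else arranged_mean (nat N) (\<lambda>y. measure (M (nat N) y) (Some -` S \<inter> space Y)) x)"
    using measL by (intro integral_cong_AE) (auto simp: AE_measure_pmf_iff)
  finally show "measure K S = \<dots>" .
qed

theorem propositionE1:
  fixes \<epsilon> \<delta> :: real and n\<^sub>0 :: nat
    and X :: "'x set" and Y :: "'y measure"
    and M :: "nat \<Rightarrow> 'x list \<Rightarrow> 'y measure"
  assumes "\<epsilon> > 0" and "\<delta> > 0"
    and "\<And>n. n \<ge> n\<^sub>0 \<Longrightarrow> randomized_algorithm (tuples X n) Y (M n)"
    and "\<And>n. n \<ge> n\<^sub>0 \<Longrightarrow> differentially_private \<epsilon> \<delta> replace_nbr (tuples X n) Y (M n)"
  shows "\<exists>Mstar :: 'x list \<Rightarrow> 'y option measure.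
    randomized_algorithm (lists X) (with_bot Y) Mstar \<and>
    differentially_private (2 * \<epsilon>) (2 * \<delta>) add_remove_replace_nbr (lists X) (with_bot Y) Mstar \<and>
    (\<exists>(\<nu> :: nat \<Rightarrow> int pmf) (J :: nat \<Rightarrow> nat \<Rightarrow> nat list pmf).
      \<forall>n.
        set_pmf (\<nu> n) \<subseteq> {int n - 2 * max 0 \<lceil>ln (2 / \<delta>) / \<epsilon>\<rceil> .. int n} \<and>
        (\<forall>N\<le>n. uniform_index_sample n N (J n N)) \<and>
        (\<forall>x\<in>tuples X n. Mstar x = subsampled_algorithm n\<^sub>0 Y M (\<nu> n) (J n) x))"
proof -
  note M = assms(3) and dp = assms(4)
  define \<tau> where "\<tau> = max 0 \<lceil>ln (2 / \<delta>) / \<epsilon>\<rceil>"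
  have "ln (2 / \<delta>) / \<epsilon> \<le> \<tau>"
    by (simp add: \<tau>_def) linarith
  then have "ln (2 / \<delta>) \<le> \<epsilon> * \<tau>"
    using assms(1) by (simp add: field_simps)
  then have "exp (- \<epsilon> * \<tau>) \<le> exp (- ln (2 / \<delta>))"
    by simp
  also have "\<dots> \<le> \<delta>"
    using assms(2) by (simp add: exp_minus)
  finally have tail: "exp (- \<epsilon> * \<tau>) \<le> \<delta>" .
  have "\<tau> \<ge> 0"
    by (simp add: \<tau>_def)
  then obtain q :: "int pmf" where q: "set_pmf q = {0..2*\<tau>}"
    and q_step: "\<And>j k. \<lbrakk>j \<in> {0..2*\<tau>}; k \<in> {0..2*\<tau>}; \<bar>j - k\<bar> \<le> 1\<rbrakk> \<Longrightarrow> pmf q j \<le> exp \<epsilon> * pmf q k"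
    and q_end: "pmf q 0 \<le> \<delta>" "pmf q (2*\<tau>) \<le> \<delta>"
    by (rule truncated_discrete_laplace_exists[OF assms(1)]) (use tail in \<open>auto intro: order_trans\<close>)
  define \<nu> where "\<nu> n = map_pmf (\<lambda>k. int n - k) q" for n
  define J where "J n N = pmf_of_set (arrangements {..<n} N)" for n N :: nat
  define Mstar where "Mstar x = subsampled_algorithm n\<^sub>0 Y M (\<nu> (length x)) (J (length x)) x" for x
  have set\<nu>: "set_pmf (\<nu> n) = {int n - 2*\<tau>..int n}" for n
    by (force simp: \<nu>_def q image_iff intro: bexI[of _ "int n - _"])
  have pmf\<nu>: "pmf (\<nu> n) N = pmf q (int n - N)" for n N
    using pmf_map_inj'[of "\<lambda>k. int n - k" q "int n - N"] by (simp add: \<nu>_def inj_on_def)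
  have Mstar_in: "Mstar x \<in> space (prob_algebra (with_bot Y))" if "x \<in> lists X" for x
    unfolding Mstar_def J_def
    by (rule subsampled_algorithm_arrangements(1)[OF M that]) (auto simp: set\<nu>)

  have dp_Mstar: "measure (Mstar x) S \<le> exp (2 * \<epsilon>) * measure (Mstar x') S + 2 * \<delta>"
    if x: "x \<in> lists X" "x' \<in> lists X" and nbr: "add_remove_replace_nbr x x'"
      and S: "S \<in> sets (with_bot Y)" for x x' S
  proof -
    define h where "h N y = measure (M N y) (Some -` S \<inter> space Y)" for N y
    define g where "g z N = (if N < int n\<^sub>0 then indicator S None
      else arranged_mean (nat N) (h (nat N)) z)" for z N
    have meas: "measure (Mstar z) S = measure_pmf.expectation (\<nu> (length z)) (g z)"
      if "z \<in> lists X" for z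
      unfolding Mstar_def J_def g_def h_def
      by (rule subsampled_algorithm_arrangements(2)[OF M that _ S]) (auto simp: set\<nu>)
    have T: "Some -` S \<inter> space Y \<in> sets Y"
      using measurable_sets[OF measurable_Some S] .
    have h: "h N y \<le> exp \<epsilon> * h N y' + \<delta>"
      if "N \<ge> n\<^sub>0" "y \<in> tuples X N" "y' \<in> tuples X N" "y = y' \<or> replace_nbr y y'" for N y y'
    proof (cases "y = y'")
      case True
      have "1 * h N y \<le> exp \<epsilon> * h N y"
        using assms(1) by (intro mult_right_mono) (auto simp: h_def)
      then show ?thesis
        using assms(2) True by simp
    next
      case False
      then show ?thesis
        using dp[OF that(1)] that T by (auto simp: differentially_private_def h_def)
    qed
    have h01: "h N y \<le> 1" if "N \<ge> n\<^sub>0" "y \<in> tuples X N" for N y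
      using M[OF that(1)] that(2) prob_space.prob_le_1
      by (fastforce simp: randomized_algorithm_def space_prob_algebra h_def)
    have g0: "g z N \<ge> 0" for z N
      by (auto simp: g_def arranged_mean_def h_def intro!: integral_nonneg_AE)
    have g1: "g x N \<le> 1" if "N \<in> set_pmf (\<nu> (length x))" for N
    proof (cases "N < int n\<^sub>0")
      case False
      then have N: "nat N \<le> length x" "nat N \<ge> n\<^sub>0"
        using that by (auto simp: set\<nu>)
      \<comment> \<open>A constant upper bound is the affine bound with slope 0.\<close>
      have "arranged_mean (nat N) (h (nat N)) x \<le> 0 * arranged_mean (nat N) (h (nat N)) x + 1"
        unfolding arranged_mean_def
        by (rule expectation_mono_affine)
          (use N x in \<open>auto simp: set_pmf_arrangements intro!: h01 arranged_in_tuples\<close>)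
      then show ?thesis
        using False by (simp add: g_def)
    qed (auto simp: g_def indicator_def)
    consider "add_nbr x x'" | "add_nbr x' x" | "replace_nbr x x'"
      using nbr by (auto simp: add_remove_replace_nbr_def)
    then obtain b where
      mass: "pmf (\<nu> (length x)) b \<le> \<delta>"
      and ratio: "\<And>N. \<lbrakk>N \<in> set_pmf (\<nu> (length x)); N \<noteq> b\<rbrakk> \<Longrightarrow>
        pmf (\<nu> (length x)) N \<le> exp \<epsilon> * pmf (\<nu> (length x')) N"
      and cond: "\<And>N. \<lbrakk>N \<in> set_pmf (\<nu> (length x)); N \<noteq> b; N \<ge> int n\<^sub>0\<rbrakk> \<Longrightarrow>
        arranged_mean (nat N) (h (nat N)) x \<le> exp \<epsilon> * arranged_mean (nat N) (h (nat N)) x' + \<delta>"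
    proof cases
      case 1
      then have len: "length x' = Suc (length x)"
        by (auto simp: add_nbr_def)
      \<comment> \<open>The smaller input can draw a sample size one below the range of the larger one.\<close>
      show thesis
      proof (rule that[of "int (length x) - 2*\<tau>"])
        show "pmf (\<nu> (length x)) (int (length x) - 2*\<tau>) \<le> \<delta>"
          using q_end by (simp add: pmf\<nu>)
        fix N assume N: "N \<in> set_pmf (\<nu> (length x))" "N \<noteq> int (length x) - 2*\<tau>"
        show "pmf (\<nu> (length x)) N \<le> exp \<epsilon> * pmf (\<nu> (length x')) N"
          unfolding pmf\<nu> by (rule q_step) (use N in \<open>auto simp: set\<nu> len\<close>)
        show "arranged_mean (nat N) (h (nat N)) x \<le> exp \<epsilon> * arranged_mean (nat N) (h (nat N)) x' + \<delta>"
          if "N \<ge> int n\<^sub>0"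
          by (rule arranged_mean_add(1)[OF 1 x(2)]) (use N that in \<open>auto simp: set\<nu> intro!: h\<close>)
      qed
    next
      case 2
      then have len: "length x = Suc (length x')"
        by (auto simp: add_nbr_def)
      \<comment> \<open>The larger input can keep all its elements, which the smaller one cannot match.\<close>
      show thesis
      proof (rule that[of "int (length x)"])
        show "pmf (\<nu> (length x)) (int (length x)) \<le> \<delta>"
          using q_end by (simp add: pmf\<nu>)
        fix N assume N: "N \<in> set_pmf (\<nu> (length x))" "N \<noteq> int (length x)"
        show "pmf (\<nu> (length x)) N \<le> exp \<epsilon> * pmf (\<nu> (length x')) N"
          unfolding pmf\<nu> by (rule q_step) (use N in \<open>auto simp: set\<nu> len\<close>)
        show "arranged_mean (nat N) (h (nat N)) x \<le> exp \<epsilon> * arranged_mean (nat N) (h (nat N)) x' + \<delta>"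
          if "N \<ge> int n\<^sub>0"
          by (rule arranged_mean_add(2)[OF 2 x(1)]) (use N that len in \<open>auto simp: set\<nu> intro!: h\<close>)
      qed
    next
      case 3
      then have len: "length x' = length x"
        by (auto simp: replace_nbr_def)
      \<comment> \<open>The laws of the sample size agree, so any end point can serve as the exceptional value.\<close>
      show thesis
      proof (rule that[of "int (length x)"])
        show "pmf (\<nu> (length x)) (int (length x)) \<le> \<delta>"
          using q_end by (simp add: pmf\<nu>)
        fix N assume N: "N \<in> set_pmf (\<nu> (length x))"
        show "pmf (\<nu> (length x)) N \<le> exp \<epsilon> * pmf (\<nu> (length x')) N"
          unfolding pmf\<nu> by (rule q_step) (use N in \<open>auto simp: set\<nu> len\<close>)
        show "arranged_mean (nat N) (h (nat N)) x \<le> exp \<epsilon> * arranged_mean (nat N) (h (nat N)) x' + \<delta>"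
          if "N \<ge> int n\<^sub>0"
          by (rule arranged_mean_replace[OF 3 x]) (use N that in \<open>auto simp: set\<nu> intro!: h\<close>)
      qed
    qed
    have g_step: "g x N \<le> exp \<epsilon> * g x' N + \<delta>" if "N \<in> set_pmf (\<nu> (length x))" "N \<noteq> b" for N
    proof -
      have "1 \<le> exp \<epsilon> + \<delta>"
        using assms(1,2) by (intro add_increasing2) auto
      then show ?thesis
        using cond[OF that] assms(2) by (auto simp: g_def indicator_def)
    qed
    have "measure_pmf.expectation (\<nu> (length x)) (g x)
        \<le> exp \<epsilon> * exp \<epsilon> * measure_pmf.expectation (\<nu> (length x')) (g x') + (\<delta> + \<delta>)"
    proof (rule expectation_dominance_compose[where b = b])
      show "finite (set_pmf (\<nu> (length x)))" "finite (set_pmf (\<nu> (length x')))"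
        by (simp_all add: set\<nu>)
    qed (use g0 g1 in \<open>auto intro!: ratio g_step mass assms(2)[THEN less_imp_le]\<close>)
    moreover have "exp (2 * \<epsilon>) = exp \<epsilon> * exp \<epsilon>"
      by (simp flip: exp_add)
    ultimately show ?thesis
      using meas x by simp
  qed

  show ?thesis
  proof (intro exI[of _ Mstar] conjI)
    show "randomized_algorithm (lists X) (with_bot Y) Mstar"
      using Mstar_in by (auto simp: randomized_algorithm_def)
    show "differentially_private (2 * \<epsilon>) (2 * \<delta>) add_remove_replace_nbr (lists X) (with_bot Y) Mstar"
      unfolding differentially_private_def using dp_Mstar by blast
    show "\<exists>(\<nu> :: nat \<Rightarrow> int pmf) (J :: nat \<Rightarrow> nat \<Rightarrow> nat list pmf).
      \<forall>n.
        set_pmf (\<nu> n) \<subseteq> {int n - 2 * max 0 \<lceil>ln (2 / \<delta>) / \<epsilon>\<rceil> .. int n} \<and>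
        (\<forall>N\<le>n. uniform_index_sample n N (J n N)) \<and>
        (\<forall>x\<in>tuples X n. Mstar x = subsampled_algorithm n\<^sub>0 Y M (\<nu> n) (J n) x)"
      by (rule exI[of _ \<nu>], rule exI[of _ J])
        (auto simp: set\<nu> \<tau>_def J_def Mstar_def tuples_def uniform_index_sample_arrangements)
  qed
qed

end
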